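(* Let $G$ be a countable abelian group acting on a measure space $(X,\mathcal{B},\mu)$ with $\mu(X)=1$ and such that $L^2(X,\mathcal{B},\mu)$ is separable. Let $A\subset G$ be any (not necessarily finite) subset and let $B\in\mathcal{B}$ have positive measure. Then for all positive integers $j<k$ we have $$c(A^k,B)^{1/k} \leq c(A^j,B)^{1/j}.$$
   Context: A group $G$ acts on a measure space $(X,\mathcal{B},\mu)$ if for each $g\in G$ the map $x\mapsto g.x$ is measure preserving, i.e. it is measurable and $\mu(gB)=\mu(B)$ for every $B\in\mathcal{B}$. For $A\subset G$ and $B\subset X$, $AB=\{a.b : a\in A, b\in B\}$. For $A\subset G$, $A^1=A$ and $A^k=A^{k-1}A$ for $k>1$ (iterated product sets). For $A\subset G$ and $B\in\mathcal{B}$ of finite positive measure, the magnification ratio is $$c(A,B)=\inf\left\{\frac{\mu(AB')}{\mu(B')} : B'\subset B \text{ measurable},\ \mu(B')>0\right\}.$$ *)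

theory Defs
  imports "HOL-Probability.Probability" "HOL-Algebra.Algebra"
begin

section \<open>Measure-preserving actions\<close>

definition measure_preserving_action ::
    "('g, 'm) monoid_scheme \<Rightarrow> 'x measure \<Rightarrow> ('g \<Rightarrow> 'x \<Rightarrow> 'x) \<Rightarrow> bool" where
  "measure_preserving_action G M \<phi> \<longleftrightarrow>
     group_action G (space M) \<phi> \<and>
     (\<forall>g\<in>carrier G. \<phi> g \<in> measurable M M \<and>
        (\<forall>B\<in>sets M. emeasure M (\<phi> g ` B) = emeasure M B))"

definition act_set :: "('g \<Rightarrow> 'x \<Rightarrow> 'x) \<Rightarrow> 'g set \<Rightarrow> 'x set \<Rightarrow> 'x set" where
  "act_set \<phi> A B = {\<phi> a b | a b. a \<in> A \<and> b \<in> B}"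

text \<open>The value at exponent \<open>0\<close> is a convention; only positive exponents matter.\<close>

fun set_power :: "('g, 'm) monoid_scheme \<Rightarrow> 'g set \<Rightarrow> nat \<Rightarrow> 'g set" where
  "set_power G A 0 = {\<one>\<^bsub>G\<^esub>}"
| "set_power G A (Suc 0) = A"
| "set_power G A (Suc (Suc n)) = set_power G A (Suc n) <#>\<^bsub>G\<^esub> A"

text \<open>
  The ratio is formed with the real-valued \<^const>\<open>measure\<close>, so the definition is meant
  for finite measures. If \<open>A\<close> is a countable set of elements of a group acting by
  measure-preserving maps, then \<open>act_set \<phi> A B'\<close> is measurable for every measurable \<open>B'\<close>.
\<close>

definition magnification_ratio ::
    "'x measure \<Rightarrow> ('g \<Rightarrow> 'x \<Rightarrow> 'x) \<Rightarrow> 'g set \<Rightarrow> 'x set \<Rightarrow> real" where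
  "magnification_ratio M \<phi> A B =
     Inf {measure M (act_set \<phi> A B') / measure M B' | B'.
            B' \<subseteq> B \<and> B' \<in> sets M \<and> measure M B' > 0}"


section \<open>The space \<open>L\<^sup>2\<close>\<close>

definition square_integrable :: "'x measure \<Rightarrow> ('x \<Rightarrow> complex) set" where
  "square_integrable M =
     {f. f \<in> borel_measurable M \<and> integrable M (\<lambda>x. (cmod (f x))\<^sup>2)}"

definition L2_space :: "'x measure \<Rightarrow> ('x \<Rightarrow> complex) set set" where
  "L2_space M = square_integrable M //
     {(f, g). f \<in> square_integrable M \<and> g \<in> square_integrable M \<and> (AE x in M. f x = g x)}"

text \<open>The distance does not depend on the chosen representatives; see \<open>L2_dist_eq\<close> below.\<close>

definition L2_dist :: "'x measure \<Rightarrow> ('x \<Rightarrow> complex) set \<Rightarrow> ('x \<Rightarrow> complex) set \<Rightarrow> real" where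
  "L2_dist M F H =
     sqrt (LINT x|M. (cmod ((SOME f. f \<in> F) x - (SOME h. h \<in> H) x))\<^sup>2)"

definition separable_L2 :: "'x measure \<Rightarrow> bool" where
  "separable_L2 M \<longleftrightarrow>
     separable_space (Metric_space.mtopology (L2_space M) (L2_dist M))"

lemma L2_space_memD:
  assumes "F \<in> L2_space M"
  shows "(SOME f. f \<in> F) \<in> F" "F \<subseteq> square_integrable M"
    and "\<And>f g. f \<in> F \<Longrightarrow> g \<in> square_integrable M \<Longrightarrow> g \<in> F \<longleftrightarrow> (AE x in M. f x = g x)"
proof -
  obtain f0 where f0: "f0 \<in> square_integrable M"
      and F: "F = {g. g \<in> square_integrable M \<and> (AE x in M. f0 x = g x)}"
    using assms by (auto simp: L2_space_def quotient_def)
  have "f0 \<in> F" using f0 F by auto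
  then show "(SOME f. f \<in> F) \<in> F" by (rule someI[of "\<lambda>f. f \<in> F"])
  show "F \<subseteq> square_integrable M" using F by auto
  fix f g assume "f \<in> F" and g: "g \<in> square_integrable M"
  then have f: "AE x in M. f0 x = f x" using F by auto
  show "g \<in> F \<longleftrightarrow> (AE x in M. f x = g x)"
  proof
    assume "g \<in> F"
    then have "AE x in M. f0 x = g x" using F by auto
    with f show "AE x in M. f x = g x" by eventually_elim simp
  next
    assume "AE x in M. f x = g x"
    with f have "AE x in M. f0 x = g x" by eventually_elim simp
    then show "g \<in> F" using F g by auto
  qed
qed

lemma square_integrable_diff:
  assumes "f \<in> square_integrable M" "g \<in> square_integrable M"
  shows "integrable M (\<lambda>x. (cmod (f x - g x))\<^sup>2)"
proof (rule Bochner_Integration.integrable_bound)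
  show "integrable M (\<lambda>x. 2 * (cmod (f x))\<^sup>2 + 2 * (cmod (g x))\<^sup>2)"
    using assms by (auto simp: square_integrable_def)
  show "(\<lambda>x. (cmod (f x - g x))\<^sup>2) \<in> borel_measurable M"
    using assms by (auto simp: square_integrable_def)
  have "(cmod (f x - g x))\<^sup>2 \<le> 2 * (cmod (f x))\<^sup>2 + 2 * (cmod (g x))\<^sup>2" for x
  proof -
    have "(cmod (f x - g x))\<^sup>2 \<le> (cmod (f x) + cmod (g x))\<^sup>2"
      by (intro power_mono norm_triangle_ineq4) auto
    also have "\<dots> \<le> 2 * (cmod (f x))\<^sup>2 + 2 * (cmod (g x))\<^sup>2"
      using zero_le_power2[of "cmod (f x) - cmod (g x)"]
      by (simp add: power2_eq_square algebra_simps)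
    finally show ?thesis .
  qed
  then show "AE x in M. norm ((cmod (f x - g x))\<^sup>2)
      \<le> norm (2 * (cmod (f x))\<^sup>2 + 2 * (cmod (g x))\<^sup>2)"
    by auto
qed

lemma L2_dist_eq:
  assumes "F \<in> L2_space M" "H \<in> L2_space M" "f \<in> F" "h \<in> H"
  shows "L2_dist M F H = sqrt (LINT x|M. (cmod (f x - h x))\<^sup>2)"
proof -
  let ?f = "SOME f. f \<in> F" and ?h = "SOME h. h \<in> H"
  have sq: "?f \<in> square_integrable M" "?h \<in> square_integrable M"
    "f \<in> square_integrable M" "h \<in> square_integrable M"
    using L2_space_memD(1,2)[OF assms(1)] L2_space_memD(1,2)[OF assms(2)] assms(3,4) by auto
  have "AE x in M. ?f x = f x" "AE x in M. ?h x = h x"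
    using L2_space_memD(1)[OF assms(1)] L2_space_memD(1)[OF assms(2)]
      L2_space_memD(3)[OF assms(1)] L2_space_memD(3)[OF assms(2)] assms sq by blast+
  then have "AE x in M. (cmod (?f x - ?h x))\<^sup>2 = (cmod (f x - h x))\<^sup>2"
    by eventually_elim simp
  then have "(LINT x|M. (cmod (?f x - ?h x))\<^sup>2) = (LINT x|M. (cmod (f x - h x))\<^sup>2)"
    using sq by (intro integral_cong_AE) (auto simp: square_integrable_def)
  then show ?thesis by (simp add: L2_dist_def)
qed

lemma L2_triangle:
  assumes f: "f \<in> square_integrable M" and g: "g \<in> square_integrable M"
    and h: "h \<in> square_integrable M"
  shows "sqrt (LINT x|M. (cmod (f x - h x))\<^sup>2)
      \<le> sqrt (LINT x|M. (cmod (f x - g x))\<^sup>2) + sqrt (LINT x|M. (cmod (g x - h x))\<^sup>2)"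
    (is "?c \<le> ?a + ?b")
proof (rule field_le_epsilon)
  fix e :: real assume e: "e > 0"
  define a b where "a = ?a + e / 2" and "b = ?b + e / 2"
  have pos: "a > 0" "b > 0" unfolding a_def b_def using e by (auto intro: add_nonneg_pos)
  have le: "(LINT x|M. (cmod (f x - g x))\<^sup>2) \<le> a\<^sup>2" "(LINT x|M. (cmod (g x - h x))\<^sup>2) \<le> b\<^sup>2"
    unfolding a_def b_def using e by (auto intro!: sqrt_le_D)
  have pt: "(cmod (f x - h x))\<^sup>2
      \<le> (1 + b / a) * (cmod (f x - g x))\<^sup>2 + (1 + a / b) * (cmod (g x - h x))\<^sup>2" for x
  proof -
    define u v where "u = cmod (f x - g x)" and "v = cmod (g x - h x)"
    have "cmod (f x - h x) \<le> u + v"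
      unfolding u_def v_def using norm_triangle_ineq[of "f x - g x" "g x - h x"] by simp
    then have "(cmod (f x - h x))\<^sup>2 \<le> (u + v)\<^sup>2" by (intro power_mono) auto
    also have "\<dots> = (1 + b / a) * u\<^sup>2 + (1 + a / b) * v\<^sup>2 - (b * u - a * v)\<^sup>2 / (a * b)"
      using pos by (simp add: field_simps power2_eq_square)
    also have "\<dots> \<le> (1 + b / a) * u\<^sup>2 + (1 + a / b) * v\<^sup>2" using pos by simp
    finally show ?thesis by (simp add: u_def v_def)
  qed
  have "(LINT x|M. (cmod (f x - h x))\<^sup>2) \<le>
      (LINT x|M. (1 + b / a) * (cmod (f x - g x))\<^sup>2 + (1 + a / b) * (cmod (g x - h x))\<^sup>2)"
    using f g h pt by (intro integral_mono) (auto intro!: square_integrable_diff)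
  also have "\<dots> = (1 + b / a) * (LINT x|M. (cmod (f x - g x))\<^sup>2)
      + (1 + a / b) * (LINT x|M. (cmod (g x - h x))\<^sup>2)"
    using f g h by (simp add: square_integrable_diff)
  also have "\<dots> \<le> (1 + b / a) * a\<^sup>2 + (1 + a / b) * b\<^sup>2"
    using le pos by (intro add_mono mult_left_mono) auto
  also have "\<dots> = (a + b)\<^sup>2" using pos by (simp add: field_simps power2_eq_square)
  finally have "?c \<le> a + b" using pos by (intro real_le_lsqrt) auto
  then show "?c \<le> ?a + ?b + e" by (simp add: a_def b_def)
qed

lemma Metric_space_L2: "Metric_space (L2_space M) (L2_dist M)"
proof
  fix F H show "0 \<le> L2_dist M F H" by (simp add: L2_dist_def)
next
  fix F H show "L2_dist M F H = L2_dist M H F" by (simp add: L2_dist_def norm_minus_commute)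
next
  fix F H assume FH: "F \<in> L2_space M" "H \<in> L2_space M"
  obtain f h where fh: "f \<in> F" "h \<in> H" using L2_space_memD(1) FH by blast
  have sq: "f \<in> square_integrable M" "h \<in> square_integrable M"
    using L2_space_memD(2) FH fh by blast+
  have "L2_dist M F H = 0 \<longleftrightarrow> (AE x in M. (cmod (f x - h x))\<^sup>2 = 0)"
    unfolding L2_dist_eq[OF FH fh]
    using integral_nonneg_eq_0_iff_AE[OF square_integrable_diff[OF sq]] by simp
  also have "\<dots> \<longleftrightarrow> (AE x in M. f x = h x)" by simp
  also have "\<dots> \<longleftrightarrow> h \<in> F" using L2_space_memD(3)[OF FH(1) fh(1) sq(2)] by simp
  also have "\<dots> \<longleftrightarrow> F = H"
  proof
    assume h: "h \<in> F"
    have "g \<in> F \<longleftrightarrow> g \<in> H" if "g \<in> square_integrable M" for g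
      using L2_space_memD(3)[OF FH(1) h that] L2_space_memD(3)[OF FH(2) fh(2) that] by simp
    then show "F = H" using L2_space_memD(2)[OF FH(1)] L2_space_memD(2)[OF FH(2)] by blast
  qed (use fh in simp)
  finally show "L2_dist M F H = 0 \<longleftrightarrow> F = H" .
next
  fix F H K assume FHK: "F \<in> L2_space M" "H \<in> L2_space M" "K \<in> L2_space M"
  obtain f h k where fhk: "f \<in> F" "h \<in> H" "k \<in> K" using L2_space_memD(1) FHK by blast
  have "f \<in> square_integrable M" "h \<in> square_integrable M" "k \<in> square_integrable M"
    using L2_space_memD(2) FHK fhk by blast+
  then show "L2_dist M F K \<le> L2_dist M F H + L2_dist M H K"
    using L2_triangle FHK fhk by (simp add: L2_dist_eq)
qed

end

theory Submission
  imports Defs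
begin

text \<open>
  The proof is the weighted minimal-cut proof of Pluennecke's inequality (Petridis), carried out
  directly in the measure space. Write \<open>c = c(A\<^sup>k, B)\<close> and let \<open>C =
  c\<^bsup>1/k\<^esup>\<close>; the case \<open>c = 0\<close> is trivial. Stack the levels
  \<open>0, \<dots>, k\<close>, each a copy of the space, and let a point \<open>x\<close> on one
  level have edges to all \<open>a.x\<close>, \<open>a \<in> A\<close>, on the next. Consider sets
  of points that meet every path from \<open>B\<close> on level \<open>0\<close> to level
  \<open>k\<close>, and charge \<open>C\<^bsup>-i\<^esup>\<close> per unit of measure on level
  \<open>i\<close>. Blocking all of \<open>B\<close> costs \<open>\<mu>(B)\<close>.

  The claim is that nothing is cheaper (\<open>measure_le_cost\<close>). It implies the theorem:
  for \<open>Z \<subseteq> B\<close>, the set that blocks \<open>B - Z\<close> on level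
  \<open>0\<close> and \<open>A\<^sup>jZ\<close> on level \<open>j\<close> costs \<open>\<mu>(B) -
  \<mu>(Z) + C\<^bsup>-j\<^esup>\<mu>(A\<^sup>jZ)\<close>, whence \<open>\<mu>(A\<^sup>jZ) \<ge>
  C\<^sup>j\<mu>(Z)\<close>. The claim is clear for a cut that uses levels \<open>0\<close> and
  \<open>k\<close> only: if \<open>Z\<close> is the part of \<open>B\<close> left unblocked, then
  \<open>A\<^sup>kZ\<close> has to be blocked on level \<open>k\<close>, at a cost of at least
  \<open>C\<^bsup>-k\<^esup>\<mu>(A\<^sup>kZ) \<ge> \<mu>(Z)\<close>. So it suffices that some cut
  of minimal cost lives on the two extreme levels.

  Minimal cuts exist (\<open>minimal_cut_exists\<close>) because the cost is submodular and lower
  semicontinuous: the upper limit of a sufficiently fast minimizing sequence is a minimizer. A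
  minimal cut can be moved off a middle level (\<open>minimal_cut_push\<close>). Here
  commutativity enters: if \<open>u \<rightarrow> a.u \<rightarrow> b.a.u\<close> is a path
  through a blocked middle vertex \<open>a.u\<close>, then \<open>b.u\<close> is another middle
  vertex between the same endpoints and is blocked as well, so degrees on either side of the cut
  can be compared. Minimality turns these comparisons into a chain of inequalities between the
  numbers of edges that enter and leave the blocked middle vertices; the chain closes up, so
  equality holds throughout, and this says that replacing the blocked vertices by their
  predecessors costs nothing (\<open>sources_le_of_local_minimality\<close>). As \<open>A\<close>
  may be infinite, edges are counted with summable weights \<open>2\<^bsup>-n\<^esup>\<close>
  along an enumeration of \<open>A\<close>.
\<close>

section \<open>The layer-cake formula\<close>

text \<open>
  Both sides compute the area below the graph of \<open>f\<close>, by Tonelli's theorem.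
\<close>

lemma (in sigma_finite_measure) nn_integral_layer_cake:
  fixes f :: "'a \<Rightarrow> ennreal"
  assumes [measurable]: "f \<in> borel_measurable M"
  shows "(\<integral>\<^sup>+x. f x \<partial>M)
    = (\<integral>\<^sup>+t. emeasure M {x \<in> space M. ennreal t < f x} * indicator {0..} t \<partial>lborel)"
proof -
  interpret P: pair_sigma_finite M lborel
    by (intro pair_sigma_finite.intro sigma_finite_measure_axioms lborel.sigma_finite_measure_axioms)
  have slice: "emeasure lborel {t. 0 \<le> t \<and> ennreal t < a} = a" for a
  proof (cases a)
    case (real r)
    then have "{t. 0 \<le> t \<and> ennreal t < a} = {0..<r}" by (auto simp: ennreal_less_iff)
    with real show ?thesis by simp
  next
    case top
    then have "{t. 0 \<le> t \<and> ennreal t < a} = {0::real..}" by auto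
    moreover have "emeasure lborel {0::real..} = \<infinity>"
    proof -
      have "ennreal (real n) \<le> emeasure lborel {0::real..}" for n
      proof -
        have "emeasure lborel {0..real n} \<le> emeasure lborel {0::real..}"
          by (intro emeasure_mono) auto
        then show ?thesis by simp
      qed
      then show ?thesis
        using ennreal_Ex_less_of_nat[of "emeasure lborel {0::real..}"]
        by (auto simp: ennreal_of_nat_eq_real_of_nat not_less[symmetric] less_top[symmetric])
    qed
    ultimately show ?thesis using top by simp
  qed
  have "(\<integral>\<^sup>+x. f x \<partial>M) = (\<integral>\<^sup>+x. (\<integral>\<^sup>+t. indicator {t. 0 \<le> t \<and> ennreal t < f x} t \<partial>lborel) \<partial>M)"
    by (simp add: slice)
  also have "\<dots> = (\<integral>\<^sup>+t. (\<integral>\<^sup>+x. indicator {t. 0 \<le> t \<and> ennreal t < f x} t \<partial>M) \<partial>lborel)"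
    by (rule P.Fubini'[symmetric]) measurable
  also have "\<dots> = (\<integral>\<^sup>+t. (\<integral>\<^sup>+x. indicator {0..} t * indicator {x \<in> space M. ennreal t < f x} x \<partial>M) \<partial>lborel)"
    by (intro nn_integral_cong) (auto simp: indicator_def)
  also have "\<dots> = (\<integral>\<^sup>+t. emeasure M {x \<in> space M. ennreal t < f x} * indicator {0..} t \<partial>lborel)"
    by (intro nn_integral_cong) (simp add: nn_integral_cmult mult.commute)
  finally show ?thesis .
qed

section \<open>Commuting transformations and weighted degrees\<close>

text \<open>
  Of the action only the enumerated maps \<open>x \<mapsto> a\<^sub>n.x\<close>, \<open>a\<^sub>n
  \<in> A\<close>, matter. Repetitions in the enumeration are harmless, so one index type serves
  finite and infinite \<open>A\<close> alike.
\<close>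

locale commuting_transformations = finite_measure M for M :: "'x measure" +
  fixes T :: "nat \<Rightarrow> 'x \<Rightarrow> 'x"
  assumes T_measurable [measurable]: "\<And>n. T n \<in> measurable M M"
    and image_sets: "\<And>n E. E \<in> sets M \<Longrightarrow> T n ` E \<in> sets M"
    and measure_image: "\<And>n E. E \<in> sets M \<Longrightarrow> measure M (T n ` E) = measure M E"
    and commute: "\<And>m n x. x \<in> space M \<Longrightarrow> T m (T n x) = T n (T m x)"
begin

definition spread :: "'x set \<Rightarrow> 'x set" where
  "spread E = (\<Union>n. T n ` E)"

lemma spread_sets [measurable]: "E \<in> sets M \<Longrightarrow> spread E \<in> sets M"
  unfolding spread_def by (intro sets.countable_UN) (auto intro: image_sets)

lemma spread_mono: "E \<subseteq> F \<Longrightarrow> spread E \<subseteq> spread F"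
  by (auto simp: spread_def)

lemma spread_Un: "spread (E \<union> F) = spread E \<union> spread F"
  by (auto simp: spread_def)

lemma spread_empty [simp]: "spread {} = {}"
  by (simp add: spread_def)

definition sources :: "'x set \<Rightarrow> 'x set \<Rightarrow> 'x set" where
  "sources P U = {u \<in> P. \<exists>n. T n u \<in> U}"

lemma sources_sets [measurable]:
  assumes [measurable]: "P \<in> sets M" "U \<in> sets M"
  shows "sources P U \<in> sets M"
proof -
  have "sources P U = {u \<in> space M. u \<in> P \<and> (\<exists>n. T n u \<in> U)}"
    using sets.sets_into_space[OF assms(1)] by (auto simp: sources_def)
  then show ?thesis by simp
qed

text \<open>
  Think of \<open>F n\<close> as the set of vertices at which the edge with label \<open>n\<close>
  is present. The weights make the degree integrable even if every vertex has infinitely many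
  edges, and they are positive, so that the support of the degree is the union of the sets
  \<open>F n\<close>.
\<close>

definition weighted_degree :: "(nat \<Rightarrow> 'x set) \<Rightarrow> 'x \<Rightarrow> ennreal" where
  "weighted_degree F x = suminf (\<lambda>n. ennreal ((1/2) ^ n) * indicator (F n) x)"

lemma weighted_degree_measurable [measurable]:
  assumes [measurable]: "\<And>n. F n \<in> sets M"
  shows "weighted_degree F \<in> borel_measurable M"
  unfolding weighted_degree_def by measurable

lemma nn_integral_weighted_degree:
  assumes [measurable]: "\<And>n. F n \<in> sets M"
  shows "(\<integral>\<^sup>+x. weighted_degree F x \<partial>M) = suminf (\<lambda>n. ennreal ((1/2) ^ n) * emeasure M (F n))"
  unfolding weighted_degree_def
  by (subst nn_integral_suminf) (auto simp: nn_integral_cmult_indicator)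

lemma nn_integral_weighted_degree_finite:
  assumes "\<And>n. F n \<in> sets M"
  shows "(\<integral>\<^sup>+x. weighted_degree F x \<partial>M) < \<infinity>"
proof -
  have "(\<integral>\<^sup>+x. weighted_degree F x \<partial>M) \<le> suminf (\<lambda>n. ennreal ((1/2) ^ n) * emeasure M (space M))"
    unfolding nn_integral_weighted_degree[OF assms]
    by (intro suminf_le mult_left_mono emeasure_space) auto
  also have "\<dots> = suminf (\<lambda>n. ennreal ((1/2) ^ n)) * emeasure M (space M)"
    by simp
  also have "suminf (\<lambda>n. ennreal ((1/2) ^ n)) = ennreal (suminf (\<lambda>n. (1/2) ^ n))"
    by (intro suminf_ennreal2) (auto intro: summable_geometric)
  finally show ?thesis
    by (rule le_less_trans) (simp add: emeasure_eq_measure ennreal_mult_less_top)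
qed

lemma weighted_degree_mono:
  assumes "\<And>n. x \<in> F n \<Longrightarrow> y \<in> F' n"
  shows "weighted_degree F x \<le> weighted_degree F' y"
  unfolding weighted_degree_def using assms
  by (intro suminf_le mult_left_mono) (auto simp: indicator_def)

lemma weighted_degree_pos_iff: "0 < weighted_degree F x \<longleftrightarrow> (\<exists>n. x \<in> F n)"
proof -
  have w: "ennreal ((1/2) ^ n) * indicator (F n) x = 0 \<longleftrightarrow> x \<notin> F n" for n
    by (cases "x \<in> F n") (auto simp: ennreal_eq_0_iff not_le)
  have "weighted_degree F x = 0 \<longleftrightarrow> (\<forall>n. ennreal ((1/2) ^ n) * indicator (F n) x = 0)"
    unfolding weighted_degree_def by (rule suminf_eq_zero_iff) auto
  then show ?thesis
    using w by (metis zero_less_iff_neq_zero)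
qed

text \<open>
  The integrals collect the superlevel measures of all heights. If these compare one way at every
  height and the other way in total, they are equal, up to the factor \<open>C\<close>, at almost
  every height. Letting the height tend to \<open>0\<close> turns this into a statement about the
  supports.
\<close>

lemma support_le_of_superlevel_le:
  fixes f g :: "'x \<Rightarrow> ennreal"
  assumes [measurable]: "f \<in> borel_measurable M" "g \<in> borel_measurable M"
    and C: "0 < C"
    and levels: "\<And>t. 0 \<le> t \<Longrightarrow> measure M {x \<in> space M. ennreal t < g x}
        \<le> C * measure M {x \<in> space M. ennreal t < f x}"
    and total: "ennreal C * (\<integral>\<^sup>+x. f x \<partial>M) \<le> (\<integral>\<^sup>+x. g x \<partial>M)"
    and fin: "(\<integral>\<^sup>+x. g x \<partial>M) < \<infinity>"
  shows "C * measure M {x \<in> space M. 0 < f x} \<le> measure M {x \<in> space M. 0 < g x}"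
proof (rule ccontr)
  define a where "a t = measure M {x \<in> space M. ennreal t < f x}" for t
  define b where "b t = measure M {x \<in> space M. ennreal t < g x}" for t
  assume "\<not> ?thesis"
  then have gap: "b 0 < C * a 0" by (simp add: a_def b_def)
  have "(\<lambda>n. a (1 / real (Suc n))) \<longlonglongrightarrow> measure M (\<Union>n. {x \<in> space M. ennreal (1 / real (Suc n)) < f x})"
    unfolding a_def
    by (intro finite_Lim_measure_incseq)
      (auto simp: incseq_def intro!: frac_le elim!: le_less_trans[OF ennreal_leI, rotated])
  also have "(\<Union>n. {x \<in> space M. ennreal (1 / real (Suc n)) < f x}) = {x \<in> space M. ennreal 0 < f x}"
  proof safe
    fix x n assume "ennreal (1 / real (Suc n)) < f x"
    then show "ennreal 0 < f x" using le_less_trans[OF zero_le] by simp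
  next
    fix x assume x: "x \<in> space M" "ennreal 0 < f x"
    then obtain r where r: "0 < r" "ennreal r < f x"
      by (metis ennreal_0 dense ennreal_less_zero_iff ennreal_cases order_less_le_trans top_greatest linorder_not_less)
    obtain n where "1 / real (Suc n) < r" using r nat_approx_posE by metis
    then have "ennreal (1 / real (Suc n)) < f x"
      using r by (meson ennreal_leI le_less_trans less_imp_le)
    then show "x \<in> (\<Union>n. {x \<in> space M. ennreal (1 / real (Suc n)) < f x})" using x by blast
  qed
  also have "measure M {x \<in> space M. ennreal 0 < f x} = a 0" by (simp add: a_def)
  finally have "(\<lambda>n. C * a (1 / real (Suc n))) \<longlonglongrightarrow> C * a 0" by (intro tendsto_intros)
  then have "eventually (\<lambda>n. b 0 < C * a (1 / real (Suc n))) sequentially"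
    using gap by (rule order_tendstoD)
  then obtain n where n: "b 0 < C * a (1 / real (Suc n))"
    by (auto simp: eventually_sequentially)
  define s where "s = 1 / real (Suc n)"
  \<comment> \<open>The superlevel measures decrease, so the gap persists at least by \<open>\<delta>\<close> on all of \<open>[0, s]\<close>.\<close>
  define \<delta> where "\<delta> = C * a s - b 0"
  have "0 < s" "0 < \<delta>" using n by (simp_all add: s_def \<delta>_def)
  have anti: "a t' \<le> a t" "b t' \<le> b t" if "0 \<le> t" "t \<le> t'" for t t'
    unfolding a_def b_def using that
    by (auto intro!: finite_measure_mono intro: le_less_trans[OF ennreal_leI])
  have pt: "ennreal (b t) * indicator {0..} t + ennreal \<delta> * indicator {0..s} t
      \<le> ennreal C * (ennreal (a t) * indicator {0..} t)" for t
  proof (cases "0 \<le> t")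
    case True
    have "b t + \<delta> * indicator {0..s} t \<le> C * a t"
    proof (cases "t \<le> s")
      case t: True
      have "b t \<le> b 0" "C * a s \<le> C * a t" using anti True t C by auto
      then show ?thesis using True t by (simp add: \<delta>_def)
    qed (use levels[OF True] in \<open>simp add: a_def b_def\<close>)
    then have "ennreal (b t + \<delta> * indicator {0..s} t) \<le> ennreal (C * a t)" by (rule ennreal_leI)
    then show ?thesis using True C \<open>0 < \<delta>\<close>
      by (auto simp: indicator_def ennreal_mult ennreal_plus a_def b_def split: if_splits)
  qed auto
  have layers: "(\<integral>\<^sup>+x. f x \<partial>M) = (\<integral>\<^sup>+t. ennreal (a t) * indicator {0..} t \<partial>lborel)"
    "(\<integral>\<^sup>+x. g x \<partial>M) = (\<integral>\<^sup>+t. ennreal (b t) * indicator {0..} t \<partial>lborel)"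
    unfolding a_def b_def by (simp_all add: nn_integral_layer_cake emeasure_eq_measure)
  have [measurable]: "(\<lambda>t. ennreal (a t)) \<in> borel_measurable borel"
      "(\<lambda>t. ennreal (b t)) \<in> borel_measurable borel"
    unfolding a_def b_def emeasure_eq_measure[symmetric] by measurable
  have "(\<integral>\<^sup>+x. g x \<partial>M) + ennreal (\<delta> * s)
      = (\<integral>\<^sup>+t. (ennreal (b t) * indicator {0..} t + ennreal \<delta> * indicator {0..s} t) \<partial>lborel)"
    using \<open>0 < s\<close> \<open>0 < \<delta>\<close>
    by (simp add: layers nn_integral_add nn_integral_cmult_indicator ennreal_mult)
  also have "\<dots> \<le> (\<integral>\<^sup>+t. ennreal C * (ennreal (a t) * indicator {0..} t) \<partial>lborel)"
    by (intro nn_integral_mono pt)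
  also have "\<dots> = ennreal C * (\<integral>\<^sup>+x. f x \<partial>M)"
    by (simp add: layers nn_integral_cmult)
  also have "\<dots> \<le> (\<integral>\<^sup>+x. g x \<partial>M)" by (rule total)
  finally have "ennreal (\<delta> * s) \<le> 0"
    using fin by (metis add.right_neutral ennreal_add_left_cancel_le linorder_neq_iff)
  then show False using \<open>0 < s\<close> \<open>0 < \<delta>\<close>
    by (simp add: ennreal_eq_0_iff) (metis linorder_not_less mult_pos_pos)
qed

text \<open>
  Three consecutive levels contain the reached sets \<open>P\<close>,
  \<open>D\<close> and \<open>F\<close>; then \<open>S\<close> is what the cut blocks on the
  middle level, and \<open>Q\<close> contains whatever would become newly reachable on the upper
  level if \<open>S\<close> were let through. The two families of hypotheses are the Hall-type
  conditions that minimality of the cut imposes on all subsets \<open>U\<close> of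
  \<open>S\<close>. The conclusion is that replacing \<open>S\<close> by its predecessors does not
  raise the cost.

  Let \<open>u \<rightarrow> s \<rightarrow> v\<close> be a path with \<open>u \<in> P\<close>,
  \<open>s \<in> S\<close>, \<open>v \<in> Q\<close>. Exchanging the order of its two labels gives
  a path from \<open>u\<close> to \<open>v\<close> whose middle vertex is in \<open>S\<close>
  again: it is reached from \<open>P\<close>, and it is not in \<open>D\<close> because
  \<open>v\<close> is not reached from \<open>D\<close>. Hence \<open>u\<close> has at least the
  out-degree into \<open>S\<close> that \<open>s\<close> has into \<open>Q\<close>, and
  \<open>v\<close> has at least the in-degree from \<open>S\<close> that \<open>s\<close> has from
  \<open>P\<close>. Applied to superlevel sets of the degrees, the Hall conditions give that the
  edges from \<open>S\<close> to \<open>Q\<close> number at most \<open>C\<close> times and at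
  least \<open>C\<close> times those from \<open>P\<close> to \<open>S\<close>. So there is
  equality at every height of the degrees, in particular at height \<open>0\<close>, which is
  about the supports.
\<close>

lemma sources_le_of_local_minimality:
  assumes [measurable]: "P \<in> sets M" "D \<in> sets M" "F \<in> sets M"
    and C: "0 < C"
    and S_def: "S = spread P - D" and Q_def: "Q = space M - (F \<union> spread D)"
    and pre: "\<And>U. U \<in> sets M \<Longrightarrow> U \<subseteq> S \<Longrightarrow> measure M U \<le> C * measure M (sources P U)"
    and post: "\<And>U. U \<in> sets M \<Longrightarrow> U \<subseteq> S \<Longrightarrow> C * measure M U \<le> measure M (spread U \<inter> Q)"
  shows "C * measure M (sources P S) \<le> measure M S"
proof -
  have [measurable]: "S \<in> sets M" "Q \<in> sets M" by (auto simp: S_def Q_def)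
  have [measurable]: "T n ` E \<in> sets M" if "E \<in> sets M" for n E using image_sets that .
  have sub: "x \<in> space M" if "x \<in> P \<or> x \<in> S \<or> x \<in> Q" for x
    using that sets.sets_into_space[of P M] sets.sets_into_space[of S M] sets.sets_into_space[of Q M]
    by auto
  have preimage_sets: "{u \<in> E. T n u \<in> E'} \<in> sets M" if [measurable]: "E \<in> sets M" "E' \<in> sets M" for E E' n
  proof -
    have "{u \<in> E. T n u \<in> E'} = {u \<in> space M. u \<in> E \<and> T n u \<in> E'}"
      using sets.sets_into_space[OF that(1)] by auto
    then show ?thesis by simp
  qed
  define out_P where "out_P = weighted_degree (\<lambda>n. {u \<in> P. T n u \<in> S})"
  define in_S where "in_S = weighted_degree (\<lambda>n. T n ` P \<inter> S)"
  define out_S where "out_S = weighted_degree (\<lambda>n. {s \<in> S. T n s \<in> Q})"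
  define in_Q where "in_Q = weighted_degree (\<lambda>n. T n ` S \<inter> Q)"
  have [measurable]: "out_P \<in> borel_measurable M" "in_S \<in> borel_measurable M"
      "out_S \<in> borel_measurable M" "in_Q \<in> borel_measurable M"
    unfolding out_P_def in_S_def out_S_def in_Q_def by (auto intro!: weighted_degree_measurable preimage_sets)
  \<comment> \<open>The two degree comparisons, obtained by exchanging labels along a path.\<close>
  have out_le: "out_S (T m u) \<le> out_P u" if "u \<in> P" "T m u \<in> S" for m u
    unfolding out_S_def out_P_def
  proof (rule weighted_degree_mono)
    fix n assume n: "T m u \<in> {s \<in> S. T n s \<in> Q}"
    have com: "T n (T m u) = T m (T n u)" using commute sub that by blast
    have "T n u \<notin> D" using n com by (auto simp: Q_def spread_def)
    then show "u \<in> {u \<in> P. T n u \<in> S}" using that by (auto simp: S_def spread_def)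
  qed
  have in_le: "in_S s \<le> in_Q (T m s)" if "s \<in> S" "T m s \<in> Q" for m s
    unfolding in_S_def in_Q_def
  proof (rule weighted_degree_mono)
    fix n assume "s \<in> T n ` P \<inter> S"
    then obtain u where u: "u \<in> P" "s = T n u" by auto
    have com: "T m s = T n (T m u)" using commute sub u by blast
    have "T m u \<notin> D" using that com by (auto simp: Q_def spread_def)
    then have "T m u \<in> S" using u by (auto simp: S_def spread_def)
    then show "T m s \<in> T n ` S \<inter> Q" using com that by blast
  qed
  \<comment> \<open>Edges with label \<open>n\<close> are counted at their tails or, as \<open>T n\<close> preserves measure, at their heads.\<close>
  have double_count: "(\<integral>\<^sup>+x. weighted_degree (\<lambda>n. {u \<in> E. T n u \<in> E'}) x \<partial>M)
      = (\<integral>\<^sup>+x. weighted_degree (\<lambda>n. T n ` E \<inter> E') x \<partial>M)" if [measurable]: "E \<in> sets M" "E' \<in> sets M" for E E'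
  proof -
    have "emeasure M {u \<in> E. T n u \<in> E'} = emeasure M (T n ` E \<inter> E')" for n
    proof -
      have "T n ` {u \<in> E. T n u \<in> E'} = T n ` E \<inter> E'" by auto
      then show ?thesis
        using measure_image[OF preimage_sets[OF that], of n n] by (simp add: emeasure_eq_measure)
    qed
    then show ?thesis
      using that by (subst (1 2) nn_integral_weighted_degree) (auto intro: preimage_sets)
  qed
  have lower: "measure M {x \<in> space M. ennreal t < out_S x}
      \<le> C * measure M {x \<in> space M. ennreal t < out_P x}" for t
  proof -
    let ?U = "{x \<in> space M. ennreal t < out_S x}"
    have US: "?U \<subseteq> S"
    proof
      fix x assume "x \<in> ?U"
      then have "0 < out_S x" by (auto intro: le_less_trans[OF zero_le])
      then show "x \<in> S" by (auto simp: out_S_def weighted_degree_pos_iff)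
    qed
    have "measure M ?U \<le> C * measure M (sources P ?U)"
      by (rule pre[OF _ US]) measurable
    also have "\<dots> \<le> C * measure M {x \<in> space M. ennreal t < out_P x}"
    proof (intro mult_left_mono finite_measure_mono)
      show "sources P ?U \<subseteq> {x \<in> space M. ennreal t < out_P x}"
      proof
        fix u assume "u \<in> sources P ?U"
        then obtain n where u: "u \<in> P" "T n u \<in> ?U" by (auto simp: sources_def)
        then have "out_S (T n u) \<le> out_P u" using out_le US by blast
        then show "u \<in> {x \<in> space M. ennreal t < out_P x}"
          using u sub by (auto intro: less_le_trans)
      qed
    qed (use C in auto)
    finally show ?thesis .
  qed
  have upper: "measure M {x \<in> space M. ennreal t < in_S x}
      \<le> (1 / C) * measure M {x \<in> space M. ennreal t < in_Q x}" for t
  proof -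
    let ?U = "{x \<in> space M. ennreal t < in_S x}"
    have US: "?U \<subseteq> S"
    proof
      fix x assume "x \<in> ?U"
      then have "0 < in_S x" by (auto intro: le_less_trans[OF zero_le])
      then show "x \<in> S" by (auto simp: in_S_def weighted_degree_pos_iff)
    qed
    have "C * measure M ?U \<le> measure M (spread ?U \<inter> Q)"
      by (rule post[OF _ US]) measurable
    also have "\<dots> \<le> measure M {x \<in> space M. ennreal t < in_Q x}"
    proof (intro finite_measure_mono)
      show "spread ?U \<inter> Q \<subseteq> {x \<in> space M. ennreal t < in_Q x}"
      proof
        fix v assume v: "v \<in> spread ?U \<inter> Q"
        then obtain n s where s: "s \<in> ?U" "v = T n s" by (auto simp: spread_def)
        then have "in_S s \<le> in_Q v" using in_le US v by blast
        then show "v \<in> {x \<in> space M. ennreal t < in_Q x}"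
          using s v sub by (auto intro: less_le_trans)
      qed
    qed auto
    finally show ?thesis using C by (simp add: field_simps)
  qed
  have "ennreal C * (\<integral>\<^sup>+x. in_S x \<partial>M) \<le> (\<integral>\<^sup>+x. in_Q x \<partial>M)"
  proof -
    have "ennreal C * (\<integral>\<^sup>+x. in_S x \<partial>M)
        = (\<integral>\<^sup>+t. ennreal C * (emeasure M {x \<in> space M. ennreal t < in_S x} * indicator {0..} t) \<partial>lborel)"
      by (simp add: nn_integral_layer_cake nn_integral_cmult)
    also have "\<dots> \<le> (\<integral>\<^sup>+t. emeasure M {x \<in> space M. ennreal t < in_Q x} * indicator {0..} t \<partial>lborel)"
    proof (intro nn_integral_mono)
      fix t :: real
      have "ennreal (C * measure M {x \<in> space M. ennreal t < in_S x})
          \<le> ennreal (measure M {x \<in> space M. ennreal t < in_Q x})"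
        using upper[of t] C by (intro ennreal_leI) (simp add: field_simps)
      then show "ennreal C * (emeasure M {x \<in> space M. ennreal t < in_S x} * indicator {0..} t)
          \<le> emeasure M {x \<in> space M. ennreal t < in_Q x} * indicator {0..} t"
        using C by (auto simp: emeasure_eq_measure ennreal_mult indicator_def)
    qed
    also have "\<dots> = (\<integral>\<^sup>+x. in_Q x \<partial>M)" by (simp add: nn_integral_layer_cake)
    finally show ?thesis .
  qed
  then have "ennreal C * (\<integral>\<^sup>+x. out_P x \<partial>M) \<le> (\<integral>\<^sup>+x. out_S x \<partial>M)"
    unfolding out_P_def in_S_def out_S_def in_Q_def by (simp add: double_count)
  moreover have "(\<integral>\<^sup>+x. out_S x \<partial>M) < \<infinity>"
    unfolding out_S_def by (rule nn_integral_weighted_degree_finite) (auto intro: preimage_sets)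
  ultimately have "C * measure M {x \<in> space M. 0 < out_P x} \<le> measure M {x \<in> space M. 0 < out_S x}"
    using C lower by (intro support_le_of_superlevel_le) auto
  also have "{x \<in> space M. 0 < out_P x} = sources P S"
    using sub by (auto simp: out_P_def weighted_degree_pos_iff sources_def)
  also have "measure M {x \<in> space M. 0 < out_S x} \<le> measure M S"
    by (intro finite_measure_mono) (auto simp: out_S_def weighted_degree_pos_iff)
  finally show ?thesis .
qed

section \<open>Layered cuts and their cost\<close>

text \<open>
  A cut is encoded by the family \<open>R\<close> of sets that remain reachable: on each level a
  path arrives in the inflow, and what is blocked is the part of the inflow outside \<open>R
  i\<close>. Nothing may be reached on level \<open>k\<close>. The sets \<open>R i\<close> may
  contain points outside the inflow; this makes the admissible families a lattice under pointwise
  union and intersection.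
\<close>

definition inflow :: "'x set \<Rightarrow> (nat \<Rightarrow> 'x set) \<Rightarrow> nat \<Rightarrow> 'x set" where
  "inflow B R i = (case i of 0 \<Rightarrow> B | Suc j \<Rightarrow> spread (R j))"

definition cut_at :: "'x set \<Rightarrow> (nat \<Rightarrow> 'x set) \<Rightarrow> nat \<Rightarrow> 'x set" where
  "cut_at B R i = inflow B R i - R i"

definition cost :: "'x set \<Rightarrow> real \<Rightarrow> nat \<Rightarrow> (nat \<Rightarrow> 'x set) \<Rightarrow> real" where
  "cost B C k R = (\<Sum>i\<le>k. measure M (cut_at B R i) / C ^ i)"

definition admissible :: "nat \<Rightarrow> (nat \<Rightarrow> 'x set) \<Rightarrow> bool" where
  "admissible k R \<longleftrightarrow> (\<forall>i. R i \<in> sets M) \<and> R k = {}"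

lemma cut_at_0: "cut_at B R 0 = B - R 0"
  and cut_at_Suc: "cut_at B R (Suc i) = spread (R i) - R (Suc i)"
  by (simp_all add: cut_at_def inflow_def)

lemma cut_at_sets:
  assumes "B \<in> sets M" "admissible k R"
  shows "cut_at B R i \<in> sets M"
  using assms by (cases i) (auto simp: cut_at_0 cut_at_Suc admissible_def)

lemma cost_nonneg: "0 < C \<Longrightarrow> 0 \<le> cost B C k R"
  unfolding cost_def by (intro sum_nonneg divide_nonneg_nonneg) auto

lemma measure_add_le_of_Un_Int:
  assumes "E \<in> sets M" "F \<in> sets M" "P \<in> sets M" "Q \<in> sets M"
    and "E \<union> F \<subseteq> P \<union> Q" "E \<inter> F \<subseteq> P \<inter> Q"
  shows "measure M E + measure M F \<le> measure M P + measure M Q"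
proof -
  have inclusion_exclusion: "measure M A + measure M B = measure M (A \<union> B) + measure M (A \<inter> B)"
    if "A \<in> sets M" "B \<in> sets M" for A B
    using that measure_Un3[of A M B] by (simp add: fmeasurable_eq_sets)
  have "measure M (E \<union> F) + measure M (E \<inter> F) \<le> measure M (P \<union> Q) + measure M (P \<inter> Q)"
    using assms by (intro add_mono finite_measure_mono) auto
  then show ?thesis
    using inclusion_exclusion[OF assms(1,2)] inclusion_exclusion[OF assms(3,4)] by linarith
qed

text \<open>
  Spreading commutes with unions and is monotone for intersections, so the inequality already
  holds for the indicator functions of the blocked sets on every level.
\<close>

lemma cost_submodular:
  assumes B: "B \<in> sets M" and C: "0 < C" and R: "admissible k R" "admissible k R'"
  shows "cost B C k (\<lambda>i. R i \<union> R' i) + cost B C k (\<lambda>i. R i \<inter> R' i) \<le> cost B C k R + cost B C k R'"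
proof -
  have adm: "admissible k (\<lambda>i. R i \<union> R' i)" "admissible k (\<lambda>i. R i \<inter> R' i)"
    using R by (auto simp: admissible_def)
  have "measure M (cut_at B (\<lambda>i. R i \<union> R' i) i) + measure M (cut_at B (\<lambda>i. R i \<inter> R' i) i)
      \<le> measure M (cut_at B R i) + measure M (cut_at B R' i)" for i
  proof (rule measure_add_le_of_Un_Int)
    show "cut_at B (\<lambda>i. R i \<union> R' i) i \<union> cut_at B (\<lambda>i. R i \<inter> R' i) i \<subseteq> cut_at B R i \<union> cut_at B R' i"
      by (cases i) (auto simp: cut_at_0 cut_at_Suc spread_def)
    show "cut_at B (\<lambda>i. R i \<union> R' i) i \<inter> cut_at B (\<lambda>i. R i \<inter> R' i) i \<subseteq> cut_at B R i \<inter> cut_at B R' i"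
      by (cases i) (auto simp: cut_at_0 cut_at_Suc spread_def)
  qed (use B R adm in \<open>auto intro: cut_at_sets\<close>)
  then have "measure M (cut_at B (\<lambda>i. R i \<union> R' i) i) / C ^ i + measure M (cut_at B (\<lambda>i. R i \<inter> R' i) i) / C ^ i
      \<le> measure M (cut_at B R i) / C ^ i + measure M (cut_at B R' i) / C ^ i" for i
    using C by (simp add: add_divide_distrib[symmetric] divide_right_mono)
  then show ?thesis
    unfolding cost_def sum.distrib[symmetric] by (intro sum_mono)
qed

text \<open>
  Fatou's lemma, for the indicator functions of the blocked sets.
\<close>

lemma cost_lower_semicontinuous:
  assumes B: "B \<in> sets M" and C: "0 < C"
    and R: "\<And>n. admissible k (R n)" and L: "admissible k L"
    and ev: "\<And>i x. x \<in> cut_at B L i \<Longrightarrow> eventually (\<lambda>n. x \<in> cut_at B (R n) i) sequentially"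
    and bound: "\<And>n. cost B C k (R n) \<le> b n" and b: "b \<longlonglongrightarrow> b'"
  shows "cost B C k L \<le> b'"
proof -
  define K where "K i n = (\<Inter>m\<in>{n..}. cut_at B (R m) i)" for i n
  have K_sets: "K i n \<in> sets M" for i n
    unfolding K_def using B R by (intro sets.countable_INT') (auto intro: cut_at_sets)
  have "incseq (K i)" for i
    by (rule incseq_SucI) (auto simp: K_def)
  then have lim: "(\<lambda>n. measure M (K i n)) \<longlonglongrightarrow> measure M (\<Union>n. K i n)" for i
    using K_sets by (intro finite_Lim_measure_incseq) auto
  have "cost B C k L \<le> (\<Sum>i\<le>k. measure M (\<Union>n. K i n) / C ^ i)"
    unfolding cost_def
  proof (intro sum_mono divide_right_mono finite_measure_mono)
    fix i show "cut_at B L i \<subseteq> (\<Union>n. K i n)"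
      using ev by (fastforce simp: K_def eventually_sequentially)
  qed (use C K_sets in auto)
  also have "\<dots> \<le> b'"
  proof (rule LIMSEQ_le[OF _ b])
    show "(\<lambda>n. \<Sum>i\<le>k. measure M (K i n) / C ^ i) \<longlonglongrightarrow> (\<Sum>i\<le>k. measure M (\<Union>n. K i n) / C ^ i)"
      using C by (intro tendsto_intros lim) auto
    have "(\<Sum>i\<le>k. measure M (K i n) / C ^ i) \<le> cost B C k (R n)" for n
      unfolding cost_def using C B R
      by (intro sum_mono divide_right_mono finite_measure_mono)
        (auto simp: K_def intro: cut_at_sets)
    then show "\<exists>N. \<forall>n\<ge>N. (\<Sum>i\<le>k. measure M (K i n) / C ^ i) \<le> b n"
      using bound order_trans by blast
  qed
  finally show ?thesis .
qed

definition minimal_cut :: "'x set \<Rightarrow> real \<Rightarrow> nat \<Rightarrow> (nat \<Rightarrow> 'x set) \<Rightarrow> bool" where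
  "minimal_cut B C k R \<longleftrightarrow>
     admissible k R \<and> (\<forall>R'. admissible k R' \<longrightarrow> cost B C k R \<le> cost B C k R')"

text \<open>
  Take cuts within \<open>2\<^bsup>-n\<^esup>\<close> of the infimum. By submodularity the excess
  of a union is at most the sum of the excesses, since the intersection costs at least the
  infimum. So the union from index \<open>N\<close> on has excess at most \<open>2 *
  2\<^bsup>-N\<^esup>\<close>, and the intersection of these unions has none. Lower semicontinuity
  is used for an increasing limit and then for a decreasing one.
\<close>

lemma minimal_cut_exists:
  assumes B: "B \<in> sets M" and C: "0 < C"
  shows "\<exists>R. minimal_cut B C k R"
proof -
  define m where "m = (INF R\<in>Collect (admissible k). cost B C k R)"
  have bdd: "bdd_below (cost B C k ` Collect (admissible k))"
    by (rule bdd_belowI[of _ 0]) (auto intro: cost_nonneg[OF C])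
  have ne: "Collect (admissible k) \<noteq> {}"
    by (auto simp: admissible_def intro!: exI[of _ "\<lambda>_. {}"])
  have m_le: "m \<le> cost B C k R" if "admissible k R" for R
    unfolding m_def using bdd that by (auto intro: cINF_lower)
  have "\<exists>R. admissible k R \<and> cost B C k R < m + (1/2) ^ n" for n
  proof -
    have "m < m + (1/2) ^ n" by simp
    then show ?thesis
      unfolding m_def cINF_less_iff[OF ne bdd] by auto
  qed
  then obtain R where R: "\<And>n. admissible k (R n)" "\<And>n. cost B C k (R n) < m + (1/2) ^ n"
    by metis
  define U where "U N l i = (\<Union>n\<in>{N..N + l}. R n i)" for N l i
  have U_adm: "admissible k (U N l)" for N l
    using R(1) by (auto simp: admissible_def U_def)
  \<comment> \<open>The subtracted term makes the geometric bound on the excess inductive.\<close>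
  have U_cost: "cost B C k (U N l) \<le> m + 2 * (1/2) ^ N - (1/2) ^ (N + l)" for N l
  proof (induction l)
    case 0
    have "U N 0 = R N" by (auto simp: U_def)
    then show ?case using R(2)[of N] by simp
  next
    case (Suc l)
    have U_Suc: "U N (Suc l) = (\<lambda>i. U N l i \<union> R (Suc (N + l)) i)"
      by (rule ext) (auto simp: U_def atLeastAtMostSuc_conv)
    have "admissible k (\<lambda>i. U N l i \<inter> R (Suc (N + l)) i)"
      using U_adm[of N l] R(1)[of "Suc (N + l)"] by (auto simp: admissible_def)
    then have "m \<le> cost B C k (\<lambda>i. U N l i \<inter> R (Suc (N + l)) i)" by (rule m_le)
    then show ?case
      using cost_submodular[OF B C U_adm[of N l] R(1)[of "Suc (N + l)"]] Suc.IH R(2)[of "Suc (N + l)"]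
      by (simp add: U_Suc)
  qed
  define V where "V N i = (\<Union>l. U N l i)" for N i
  have V_adm: "admissible k (V N)" for N
    using U_adm by (auto simp: admissible_def V_def)
  have U_mono: "U N l i \<subseteq> U N l' i" if "l \<le> l'" for N l l' i
    unfolding U_def using that by (intro UN_mono) auto
  have V_cost: "cost B C k (V N) \<le> m + 2 * (1/2) ^ N" for N
  proof (rule cost_lower_semicontinuous[OF B C U_adm V_adm])
    fix i x assume x: "x \<in> cut_at B (V N) i"
    show "eventually (\<lambda>l. x \<in> cut_at B (U N l) i) sequentially"
    proof (cases i)
      case 0
      then show ?thesis using x by (auto simp: V_def cut_at_0)
    next
      case (Suc j)
      then obtain n y l where "y \<in> U N l j" "x = T n y" and out: "\<And>l. x \<notin> U N l i"
        using x by (auto simp: V_def spread_def cut_at_Suc)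
      then have "x \<in> cut_at B (U N l') i" if "l \<le> l'" for l'
        using U_mono[OF that, of N j] Suc by (auto simp: spread_def cut_at_Suc)
      then show ?thesis by (auto simp: eventually_sequentially)
    qed
  next
    show "cost B C k (U N l) \<le> m + 2 * (1/2) ^ N" for l
      using U_cost[of N l] by (rule order_trans) simp
  qed simp
  define W where "W i = (\<Inter>N. V N i)" for i
  have W_adm: "admissible k W"
    using V_adm by (auto simp: admissible_def W_def)
  have V_anti: "V N' i \<subseteq> V N i" if "N \<le> N'" for N N' i
  proof
    fix x assume "x \<in> V N' i"
    then obtain n where "N' \<le> n" "x \<in> R n i" by (auto simp: V_def U_def)
    then have "x \<in> U N (n - N) i" using that by (auto simp: U_def)
    then show "x \<in> V N i" by (auto simp: V_def)
  qed
  have "cost B C k W \<le> m"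
  proof (rule cost_lower_semicontinuous[OF B C V_adm W_adm _ V_cost])
    fix i x assume x: "x \<in> cut_at B W i"
    then obtain N where N: "x \<notin> V N i" by (cases i) (auto simp: cut_at_0 cut_at_Suc W_def)
    have "x \<in> cut_at B (V N') i" if "N \<le> N'" for N'
    proof -
      have "x \<notin> V N' i" using V_anti[OF that] N by auto
      moreover have "x \<in> inflow B (V N') i"
        using x by (cases i) (auto simp: cut_at_0 cut_at_Suc inflow_def W_def spread_def)
      ultimately show ?thesis by (simp add: cut_at_def)
    qed
    then show "eventually (\<lambda>N. x \<in> cut_at B (V N) i) sequentially"
      by (auto simp: eventually_sequentially)
  next
    have "(\<lambda>N. m + 2 * (1/2) ^ N) \<longlonglongrightarrow> m + 2 * 0"
      by (intro tendsto_intros LIMSEQ_power_zero) auto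
    then show "(\<lambda>N. m + 2 * (1/2) ^ N) \<longlonglongrightarrow> m" by simp
  qed
  then show ?thesis
    using W_adm m_le order_trans unfolding minimal_cut_def by blast
qed

text \<open>
  The bookkeeping common to the two local modifications of a cut below: level \<open>a\<close>
  gains at most \<open>x\<close> in blocked measure and level \<open>b\<close> loses at least
  \<open>y\<close>.
\<close>

lemma cost_shift:
  assumes "a \<le> k" "b \<le> k" and C: "0 < C"
    and change: "\<And>i. measure M (cut_at B R' i)
      \<le> measure M (cut_at B R i) + (if i = a then x else 0) - (if i = b then y else 0)"
  shows "cost B C k R' \<le> cost B C k R + x / C ^ a - y / C ^ b"
proof -
  have "cost B C k R' \<le> (\<Sum>i\<le>k. measure M (cut_at B R i) / C ^ i
      + (if i = a then x / C ^ i else 0) - (if i = b then y / C ^ i else 0))"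
    unfolding cost_def
  proof (rule sum_mono)
    fix i
    have "measure M (cut_at B R' i) / C ^ i
        \<le> (measure M (cut_at B R i) + (if i = a then x else 0) - (if i = b then y else 0)) / C ^ i"
      using change C by (intro divide_right_mono) auto
    then show "measure M (cut_at B R' i) / C ^ i \<le> measure M (cut_at B R i) / C ^ i
        + (if i = a then x / C ^ i else 0) - (if i = b then y / C ^ i else 0)"
      by (simp add: add_divide_distrib diff_divide_distrib split: if_splits)
  qed
  also have "\<dots> = cost B C k R + x / C ^ a - y / C ^ b"
    using assms by (simp add: cost_def sum.distrib sum_subtractf)
  finally show ?thesis .
qed

lemma measure_le_diff_of_subset:
  assumes "E \<in> sets M" "F \<in> sets M" "E' \<in> sets M" "F \<subseteq> E" "E' \<subseteq> E - F"
  shows "measure M E' \<le> measure M E - measure M F"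
proof -
  have "measure M E' \<le> measure M (E - F)" using assms by (intro finite_measure_mono) auto
  then show ?thesis using assms by (simp add: finite_measure_Diff)
qed

lemma measure_le_add_of_subset:
  assumes "E \<in> sets M" "F \<in> sets M" "E' \<subseteq> E \<union> F"
  shows "measure M E' \<le> measure M E + measure M F"
proof -
  have "measure M E' \<le> measure M (E \<union> F)" using assms by (intro finite_measure_mono) auto
  then show ?thesis using assms measure_Un_le[of E M F] by linarith
qed

text \<open>
  Instead of blocking \<open>U\<close> on level \<open>j + 1\<close>, one may block on level
  \<open>j\<close> the points that lead into \<open>U\<close>.
\<close>

lemma cost_lower_cut:
  assumes B: "B \<in> sets M" and C: "0 < C" and R: "admissible k R" and j: "Suc j < k"
    and U: "U \<in> sets M" "U \<subseteq> cut_at B R (Suc j)"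
  defines "R' \<equiv> R(j := R j - sources (R j) U)"
  shows "admissible k R'"
    and "cost B C k R' \<le> cost B C k R + measure M (sources (R j) U) / C ^ j - measure M U / C ^ Suc j"
proof -
  have N: "sources (R j) U \<in> sets M" using R U by (auto simp: admissible_def)
  show R': "admissible k R'" using R N j by (auto simp: admissible_def R'_def)
  have sets: "cut_at B R i \<in> sets M" "cut_at B R' i \<in> sets M" for i
    using B R R' by (auto intro!: cut_at_sets)
  show "cost B C k R' \<le> cost B C k R + measure M (sources (R j) U) / C ^ j - measure M U / C ^ Suc j"
  proof (rule cost_shift)
    fix i
    consider "i = j" | "i = Suc j" | "i \<noteq> j" "i \<noteq> Suc j" by blast
    then show "measure M (cut_at B R' i) \<le> measure M (cut_at B R i)
        + (if i = j then measure M (sources (R j) U) else 0) - (if i = Suc j then measure M U else 0)"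
    proof cases
      case 1
      have "cut_at B R' j \<subseteq> cut_at B R j \<union> sources (R j) U"
        by (cases j) (auto simp: cut_at_0 cut_at_Suc R'_def)
      then show ?thesis
        using 1 measure_le_add_of_subset[OF sets(1) N] by simp
    next
      case 2
      have "cut_at B R' (Suc j) \<subseteq> cut_at B R (Suc j) - U"
        by (auto simp: cut_at_Suc R'_def spread_def sources_def)
      then show ?thesis
        using 2 measure_le_diff_of_subset[OF sets(1) U(1) sets(2) U(2)] by simp
    next
      case 3
      then have "cut_at B R' i = cut_at B R i" by (cases i) (auto simp: cut_at_0 cut_at_Suc R'_def)
      then show ?thesis using 3 by simp
    qed
  qed (use j C in auto)
qed

text \<open>
  Instead of blocking \<open>U\<close> on level \<open>i\<close>, one may let it pass and block on
  level \<open>i + 1\<close> what thereby becomes newly reachable.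
\<close>

lemma cost_raise_cut:
  assumes B: "B \<in> sets M" and C: "0 < C" and R: "admissible k R" and i: "i < k"
    and U: "U \<in> sets M" "U \<subseteq> cut_at B R i"
  defines "N \<equiv> spread U - (R (Suc i) \<union> spread (R i))"
  defines "R' \<equiv> R(i := R i \<union> U)"
  shows "admissible k R'"
    and "cost B C k R' \<le> cost B C k R + measure M N / C ^ Suc i - measure M U / C ^ i"
proof -
  have N: "N \<in> sets M" using R U by (auto simp: admissible_def N_def)
  show R': "admissible k R'" using R U i by (auto simp: admissible_def R'_def)
  have sets: "cut_at B R i \<in> sets M" "cut_at B R' i \<in> sets M" for i
    using B R R' by (auto intro!: cut_at_sets)
  show "cost B C k R' \<le> cost B C k R + measure M N / C ^ Suc i - measure M U / C ^ i"
  proof (rule cost_shift)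
    fix l
    consider "l = i" | "l = Suc i" | "l \<noteq> i" "l \<noteq> Suc i" by blast
    then show "measure M (cut_at B R' l) \<le> measure M (cut_at B R l)
        + (if l = Suc i then measure M N else 0) - (if l = i then measure M U else 0)"
    proof cases
      case 1
      have "cut_at B R' i \<subseteq> cut_at B R i - U"
        by (cases i) (auto simp: cut_at_0 cut_at_Suc R'_def)
      then show ?thesis
        using 1 measure_le_diff_of_subset[OF sets(1) U(1) sets(2) U(2)] by simp
    next
      case 2
      have "cut_at B R' (Suc i) \<subseteq> cut_at B R (Suc i) \<union> N"
        by (auto simp: cut_at_Suc R'_def N_def spread_Un)
      then show ?thesis
        using 2 measure_le_add_of_subset[OF sets(1) N] by simp
    next
      case 3
      then have "cut_at B R' l = cut_at B R l" by (cases l) (auto simp: cut_at_0 cut_at_Suc R'_def)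
      then show ?thesis using 3 by simp
    qed
  qed (use i C in auto)
qed

section \<open>Pushing a minimal cut to the extreme levels\<close>

text \<open>
  The two modifications, applied to all subsets of the part of the cut on level \<open>j +
  1\<close>, cannot lower the cost of a minimal cut; this supplies the hypotheses of
  \<open>sources_le_of_local_minimality\<close>, by which moving that whole part down one level
  does not raise the cost either.
\<close>

lemma minimal_cut_push:
  assumes B: "B \<in> sets M" and C: "0 < C" and R: "minimal_cut B C k R" and j: "Suc j < k"
  shows "\<exists>R'. minimal_cut B C k R' \<and> cut_at B R' (Suc j) = {} \<and> (\<forall>i>Suc j. cut_at B R' i = cut_at B R i)"
proof -
  define S where "S = cut_at B R (Suc j)"
  define Q where "Q = space M - (R (Suc (Suc j)) \<union> spread (R (Suc j)))"
  define R' where "R' = R(j := R j - sources (R j) S)"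
  have adm: "admissible k R" and min: "\<And>R'. admissible k R' \<Longrightarrow> cost B C k R \<le> cost B C k R'"
    using R by (auto simp: minimal_cut_def)
  have R_sets: "R i \<in> sets M" for i using adm by (simp add: admissible_def)
  have S_sets: "S \<in> sets M" using B adm by (auto simp: S_def intro: cut_at_sets)
  have "C * measure M (sources (R j) S) \<le> measure M S"
  proof (rule sources_le_of_local_minimality[OF R_sets R_sets R_sets C _ Q_def])
    show "S = spread (R j) - R (Suc j)" by (simp add: S_def cut_at_Suc)
    fix U assume U: "U \<in> sets M" "U \<subseteq> S"
    note lower = cost_lower_cut[OF B C adm j U[unfolded S_def]]
      and raise = cost_raise_cut[OF B C adm j U[unfolded S_def]]
    have "0 \<le> measure M (sources (R j) U) / C ^ j - measure M U / C ^ Suc j"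
      using min[OF lower(1)] lower(2) by linarith
    then show "measure M U \<le> C * measure M (sources (R j) U)"
      using C by (simp add: field_simps)
    have "0 \<le> measure M (spread U - (R (Suc (Suc j)) \<union> spread (R (Suc j)))) / C ^ Suc (Suc j)
        - measure M U / C ^ Suc j"
      using min[OF raise(1)] raise(2) by linarith
    moreover have "spread U - (R (Suc (Suc j)) \<union> spread (R (Suc j))) = spread U \<inter> Q"
      using sets.sets_into_space[OF spread_sets[OF U(1)]] by (auto simp: Q_def)
    ultimately show "C * measure M U \<le> measure M (spread U \<inter> Q)"
      using C by (simp add: field_simps)
  qed
  then have gain: "measure M (sources (R j) S) / C ^ j - measure M S / C ^ Suc j \<le> 0"
    using C by (simp add: field_simps)
  have R': "admissible k R'"
    "cost B C k R' \<le> cost B C k R + measure M (sources (R j) S) / C ^ j - measure M S / C ^ Suc j"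
    unfolding R'_def using cost_lower_cut[OF B C adm j S_sets] by (auto simp: S_def)
  have "minimal_cut B C k R'"
    unfolding minimal_cut_def
  proof (intro conjI allI impI)
    fix L assume "admissible k L"
    then show "cost B C k R' \<le> cost B C k L" using min[of L] R'(2) gain by linarith
  qed (rule R'(1))
  moreover have "cut_at B R' (Suc j) = {}"
    by (auto simp: cut_at_Suc R'_def S_def sources_def spread_def)
  moreover have "cut_at B R' i = cut_at B R i" if "Suc j < i" for i
    using that by (cases i) (auto simp: cut_at_0 cut_at_Suc R'_def)
  ultimately show ?thesis by blast
qed

text \<open>
  The middle levels are cleared from the top downwards, since a push affects only its own level
  and the one below it.
\<close>

lemma minimal_cut_extreme_levels:
  assumes B: "B \<in> sets M" and C: "0 < C" and k: "0 < k"
  shows "\<exists>R. minimal_cut B C k R \<and> (\<forall>i. 0 < i \<and> i < k \<longrightarrow> cut_at B R i = {})"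
proof (rule inc_induct[of 0 "k - 1"])
  show "\<exists>R. minimal_cut B C k R \<and> (\<forall>i. k - 1 < i \<and> i < k \<longrightarrow> cut_at B R i = {})"
  proof -
    obtain R where "minimal_cut B C k R" using minimal_cut_exists[OF B C] by blast
    moreover have "\<not> (k - 1 < i \<and> i < k)" for i by arith
    ultimately show ?thesis by blast
  qed
next
  fix n assume n: "n < k - 1"
  assume "\<exists>R. minimal_cut B C k R \<and> (\<forall>i. Suc n < i \<and> i < k \<longrightarrow> cut_at B R i = {})"
  then obtain R where R: "minimal_cut B C k R" "\<And>i. Suc n < i \<Longrightarrow> i < k \<Longrightarrow> cut_at B R i = {}"
    by blast
  have "Suc n < k" using n by simp
  from minimal_cut_push[OF B C R(1) this] obtain R' where R': "minimal_cut B C k R'"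
      "cut_at B R' (Suc n) = {}" "\<And>i. Suc n < i \<Longrightarrow> cut_at B R' i = cut_at B R i" by blast
  have "cut_at B R' i = {}" if "n < i" "i < k" for i
    using R' R(2) that by (cases "i = Suc n") auto
  then show "\<exists>R. minimal_cut B C k R \<and> (\<forall>i. n < i \<and> i < k \<longrightarrow> cut_at B R i = {})"
    using R'(1) by blast
qed simp

lemma funpow_spread_sets: "E \<in> sets M \<Longrightarrow> (spread ^^ i) E \<in> sets M"
  by (induction i) auto

text \<open>
  Let \<open>L\<close> be a minimal cut on the levels \<open>0\<close> and \<open>k\<close>, and
  \<open>Z\<close> the part of \<open>B\<close> that it leaves unblocked. Then every path from
  \<open>Z\<close> is stopped on level \<open>k\<close> only, and the expansion hypothesis makes
  that cost at least the measure of \<open>Z\<close>.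
\<close>

lemma measure_le_cost:
  assumes B: "B \<in> sets M" and C: "0 < C" and k: "0 < k"
    and expand: "\<And>Z. Z \<in> sets M \<Longrightarrow> Z \<subseteq> B \<Longrightarrow> C ^ k * measure M Z \<le> measure M ((spread ^^ k) Z)"
    and R: "admissible k R"
  shows "measure M B \<le> cost B C k R"
proof -
  obtain L where L: "minimal_cut B C k L" "\<And>i. 0 < i \<Longrightarrow> i < k \<Longrightarrow> cut_at B L i = {}"
    using minimal_cut_extreme_levels[OF B C k] by blast
  have adm: "admissible k L" using L(1) by (simp add: minimal_cut_def)
  then have L_sets: "L i \<in> sets M" for i by (simp add: admissible_def)
  define Z where "Z = B \<inter> L 0"
  have Z: "Z \<in> sets M" "Z \<subseteq> B" using B L_sets by (auto simp: Z_def)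
  have step: "(spread ^^ i) Z \<subseteq> L i" if "i < k" for i
    using that
  proof (induction i)
    case (Suc i)
    then have "(spread ^^ i) Z \<subseteq> L i" by simp
    then have "spread ((spread ^^ i) Z) \<subseteq> spread (L i)" by (rule spread_mono)
    also have "spread (L i) \<subseteq> L (Suc i)" using L(2)[of "Suc i"] Suc.prems by (auto simp: cut_at_Suc)
    finally show ?case by simp
  qed (auto simp: Z_def)
  obtain k' where k': "k = Suc k'" using k by (cases k) auto
  have "spread ((spread ^^ k') Z) \<subseteq> spread (L k')"
    using step[of k'] k' by (intro spread_mono) auto
  also have "spread (L k') = cut_at B L k"
    using adm k' by (auto simp: admissible_def cut_at_Suc)
  finally have "measure M ((spread ^^ k) Z) \<le> measure M (cut_at B L k)"
    using B adm k' by (intro finite_measure_mono cut_at_sets) auto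
  with expand[OF Z] have "C ^ k * measure M Z \<le> measure M (cut_at B L k)" by linarith
  then have top: "measure M Z \<le> measure M (cut_at B L k) / C ^ k"
    using C by (simp add: field_simps)
  have "measure M B \<le> measure M (B - L 0) + measure M Z"
    using B L_sets Z by (intro measure_le_add_of_subset) (auto simp: Z_def)
  also have "\<dots> \<le> measure M (B - L 0) + measure M (cut_at B L k) / C ^ k" using top by simp
  also have "\<dots> = (\<Sum>i\<in>{0, k}. measure M (cut_at B L i) / C ^ i)"
    using k by (simp add: cut_at_0)
  also have "\<dots> \<le> cost B C k L"
    unfolding cost_def using C by (intro sum_mono2) auto
  also have "\<dots> \<le> cost B C k R" using L(1) R by (simp add: minimal_cut_def)
  finally show ?thesis .
qed

text \<open>
  Pluennecke's inequality for commuting transformations, in the form that a lower bound on the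
  growth under \<open>k\<close> steps, valid for all subsets of \<open>B\<close>, passes to
  \<open>j\<close> steps. It compares the trivial cut \<open>B\<close> with the cut formed by
  \<open>B - Z\<close> and the \<open>j\<close>-fold spread of \<open>Z\<close>.
\<close>

theorem iterated_spread_lower_bound:
  assumes B: "B \<in> sets M" and C: "0 < C" and j: "0 < j" "j \<le> k"
    and expand: "\<And>Z. Z \<in> sets M \<Longrightarrow> Z \<subseteq> B \<Longrightarrow> C ^ k * measure M Z \<le> measure M ((spread ^^ k) Z)"
    and Z: "Z \<in> sets M" "Z \<subseteq> B"
  shows "C ^ j * measure M Z \<le> measure M ((spread ^^ j) Z)"
proof -
  define R where "R i = (if i < j then (spread ^^ i) Z else {})" for i
  have R: "admissible k R"
    using j Z by (auto simp: admissible_def R_def intro: funpow_spread_sets)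
  have cut_at_R: "cut_at B R i = (if i = 0 then B - Z else if i = j then (spread ^^ j) Z else {})" for i
  proof (cases i)
    case (Suc l)
    have "l < j \<Longrightarrow> \<not> Suc l < j \<Longrightarrow> Suc l = j" by simp
    then show ?thesis using Suc j by (auto simp: R_def cut_at_Suc)
  qed (use j in \<open>auto simp: R_def cut_at_0\<close>)
  have "measure M B \<le> cost B C k R"
    using measure_le_cost[OF B C _ expand R] j by simp
  also have "\<dots> = (\<Sum>i\<in>{0, j}. measure M (cut_at B R i) / C ^ i)"
    unfolding cost_def using j by (intro sum.mono_neutral_right) (auto simp: cut_at_R)
  also have "\<dots> = measure M (B - Z) + measure M ((spread ^^ j) Z) / C ^ j"
    using j by (simp add: cut_at_R)
  also have "measure M (B - Z) = measure M B - measure M Z"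
    using B Z by (simp add: finite_measure_Diff)
  finally show ?thesis using C by (simp add: field_simps)
qed

end

section \<open>Group actions and magnification ratios\<close>

lemma act_set_set_mult:
  fixes G :: "('g, 'm) monoid_scheme"
  assumes "group_action G Y \<phi>" "H \<subseteq> carrier G" "A \<subseteq> carrier G" "E \<subseteq> Y"
  shows "act_set \<phi> (H <#>\<^bsub>G\<^esub> A) E = act_set \<phi> H (act_set \<phi> A E)"
proof -
  have comp: "\<phi> (h \<otimes>\<^bsub>G\<^esub> a) x = \<phi> h (\<phi> a x)" if "h \<in> H" "a \<in> A" "x \<in> E" for h a x
    using that assms by (intro group_action.composition_rule[OF assms(1)]) auto
  show ?thesis
  proof (intro equalityI subsetI)
    fix y assume "y \<in> act_set \<phi> (H <#>\<^bsub>G\<^esub> A) E"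
    then obtain h a x where "h \<in> H" "a \<in> A" "x \<in> E" "y = \<phi> (h \<otimes>\<^bsub>G\<^esub> a) x"
      by (auto simp: act_set_def set_mult_def)
    then show "y \<in> act_set \<phi> H (act_set \<phi> A E)"
      using comp by (auto simp: act_set_def)
  next
    fix y assume "y \<in> act_set \<phi> H (act_set \<phi> A E)"
    then obtain h a x where hax: "h \<in> H" "a \<in> A" "x \<in> E" "y = \<phi> h (\<phi> a x)"
      by (auto simp: act_set_def)
    then have "y = \<phi> (h \<otimes>\<^bsub>G\<^esub> a) x" "h \<otimes>\<^bsub>G\<^esub> a \<in> H <#>\<^bsub>G\<^esub> A"
      using comp by (auto simp: set_mult_def)
    then show "y \<in> act_set \<phi> (H <#>\<^bsub>G\<^esub> A) E"
      using hax(3) unfolding act_set_def by blast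
  qed
qed

lemma set_power_subset_carrier:
  fixes G :: "('g, 'm) monoid_scheme"
  assumes "group G" "A \<subseteq> carrier G"
  shows "set_power G A (Suc n) \<subseteq> carrier G"
proof (induction n)
  case (Suc n)
  have "x \<otimes>\<^bsub>G\<^esub> a \<in> carrier G" if "x \<in> set_power G A (Suc n)" "a \<in> A" for x a
    using that Suc.IH assms by (auto intro: monoid.m_closed group.is_monoid)
  then show ?case by (auto simp: set_mult_def)
qed (use assms in simp)

lemma act_set_set_power:
  assumes act: "group_action G Y \<phi>" and G: "group G" and A: "A \<subseteq> carrier G" and E: "E \<subseteq> Y"
  shows "act_set \<phi> (set_power G A (Suc n)) E = (act_set \<phi> A ^^ Suc n) E"
  using E
proof (induction n arbitrary: E)
  case (Suc n)
  have "act_set \<phi> A E \<subseteq> Y"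
    using Suc.prems A group_action.element_image[OF act] by (fastforce simp: act_set_def)
  have "act_set \<phi> (set_power G A (Suc (Suc n))) E
      = act_set \<phi> (set_power G A (Suc n)) (act_set \<phi> A E)"
    using act_set_set_mult[OF act set_power_subset_carrier[OF G A] A Suc.prems] by simp
  also have "\<dots> = (act_set \<phi> A ^^ Suc n) (act_set \<phi> A E)"
    by (rule Suc.IH) fact
  also have "\<dots> = (act_set \<phi> A ^^ Suc (Suc n)) E"
    by (simp only: funpow_swap1 funpow.simps o_apply)
  finally show ?case .
qed simp

text \<open>
  The image under \<open>g\<close> is the preimage under the inverse of \<open>g\<close>, which
  acts measurably as well.
\<close>

lemma measure_preserving_action_image_sets:
  assumes act: "measure_preserving_action G M \<phi>" and g: "g \<in> carrier G" and E: "E \<in> sets M"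
  shows "\<phi> g ` E \<in> sets M"
proof -
  from act have ga: "group_action G (space M) \<phi>"
    by (simp add: measure_preserving_action_def)
  then interpret group_action G "space M" \<phi> .
  interpret group G using group_hom group_hom.axioms(1) by auto
  have inv: "inv\<^bsub>G\<^esub> g \<in> carrier G" using g by simp
  have "\<phi> g ` E = \<phi> (inv\<^bsub>G\<^esub> g) -` E \<inter> space M"
  proof (intro equalityI subsetI)
    fix y assume "y \<in> \<phi> g ` E"
    then obtain x where x: "x \<in> E" "y = \<phi> g x" by auto
    then have "x \<in> space M" using sets.sets_into_space[OF E] by auto
    then show "y \<in> \<phi> (inv\<^bsub>G\<^esub> g) -` E \<inter> space M"
      using orbit_sym_aux[OF g _ x(2)[symmetric]] element_image[OF g _ x(2)[symmetric]] x by simp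
  next
    fix y assume y: "y \<in> \<phi> (inv\<^bsub>G\<^esub> g) -` E \<inter> space M"
    then have "\<phi> g (\<phi> (inv\<^bsub>G\<^esub> g) y) = y"
      using orbit_sym_aux[OF inv, of y] g by simp
    then show "y \<in> \<phi> g ` E" using y by (metis IntD1 image_eqI vimageE)
  qed
  then show ?thesis
    using act inv E by (auto simp: measure_preserving_action_def)
qed

lemma commuting_transformations_of_action:
  assumes G: "comm_group G" and M: "finite_measure M" and act: "measure_preserving_action G M \<phi>"
    and a: "\<And>n. a n \<in> carrier G"
  shows "commuting_transformations M (\<lambda>n. \<phi> (a n))"
proof -
  interpret comm_group G by fact
  from act have ga: "group_action G (space M) \<phi>"
    by (simp add: measure_preserving_action_def)
  show ?thesis
  proof (intro commuting_transformations.intro M commuting_transformations_axioms.intro)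
    fix m n x assume "x \<in> space M"
    then show "\<phi> (a m) (\<phi> (a n) x) = \<phi> (a n) (\<phi> (a m) x)"
      using group_action.composition_rule[OF ga _ a a] m_comm[OF a a] by metis
  next
    fix n E assume "E \<in> sets M"
    then show "\<phi> (a n) ` E \<in> sets M"
      by (rule measure_preserving_action_image_sets[OF act a])
  next
    fix n E assume "E \<in> sets M"
    then show "measure M (\<phi> (a n) ` E) = measure M E"
      using act a by (simp add: measure_preserving_action_def measure_def)
  qed (use act a in \<open>auto simp: measure_preserving_action_def\<close>)
qed

lemma magnification_ratio_nonneg:
  assumes "B \<in> sets M" "measure M B > 0"
  shows "0 \<le> magnification_ratio M \<phi> A B"
  unfolding magnification_ratio_def
  using assms by (intro cInf_greatest) auto

lemma magnification_ratio_le: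
  assumes "Z \<in> sets M" "Z \<subseteq> B"
  shows "magnification_ratio M \<phi> A B * measure M Z \<le> measure M (act_set \<phi> A Z)"
proof (cases "measure M Z > 0")
  case True
  have "magnification_ratio M \<phi> A B \<le> measure M (act_set \<phi> A Z) / measure M Z"
    unfolding magnification_ratio_def
    by (rule cInf_lower) (use assms True in \<open>auto intro!: bdd_belowI[of _ 0]\<close>)
  with True show ?thesis by (simp add: field_simps)
next
  case False
  then have "measure M Z = 0" using measure_nonneg[of M Z] by linarith
  then show ?thesis by simp
qed

lemma magnification_ratio_ge:
  assumes "B \<in> sets M" "measure M B > 0"
    and "\<And>Z. Z \<in> sets M \<Longrightarrow> Z \<subseteq> B \<Longrightarrow> c * measure M Z \<le> measure M (act_set \<phi> A Z)"
  shows "c \<le> magnification_ratio M \<phi> A B"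
  unfolding magnification_ratio_def
  using assms by (intro cInf_greatest) (auto simp: field_simps)

theorem theorem1p8:
  fixes G :: "('g, 'm) monoid_scheme" and M :: "'x measure"
    and \<phi> :: "'g \<Rightarrow> 'x \<Rightarrow> 'x" and A :: "'g set" and B :: "'x set" and j k :: nat
  assumes "comm_group G" and "countable (carrier G)"
    and "prob_space M"
    and "measure_preserving_action G M \<phi>"
    and "separable_L2 M"
    and "A \<subseteq> carrier G"
    and "B \<in> sets M" and "measure M B > 0"
    and "0 < j" and "j < k"
  shows "magnification_ratio M \<phi> (set_power G A k) B powr (1 / real k)
       \<le> magnification_ratio M \<phi> (set_power G A j) B powr (1 / real j)"
proof -
  note G = assms(1) and act = assms(4) and A = assms(6) and B = assms(7,8) and jk = assms(9,10)
  let ?c = "\<lambda>i. magnification_ratio M \<phi> (set_power G A i) B"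
  define C where "C = ?c k powr (1 / real k)"
  have ga: "group_action G (space M) \<phi>"
    using act by (simp add: measure_preserving_action_def)
  have grp: "group G" using G by (simp add: comm_group_def)
  have iterate: "act_set \<phi> (set_power G A i) Z = (act_set \<phi> A ^^ i) Z"
    if "0 < i" "Z \<in> sets M" for i Z
    using act_set_set_power[OF ga grp A sets.sets_into_space[OF that(2)], of "i - 1"] that(1) by simp
  show ?thesis
  proof (cases "?c k = 0")
    case True
    then show ?thesis by simp
  next
    case False
    then have ck: "0 < ?c k" using magnification_ratio_nonneg[OF B] by (simp add: less_le)
    have C: "0 < C" "C ^ k = ?c k"
      using ck jk by (auto simp: C_def powr_realpow[symmetric] powr_powr)
    \<comment> \<open>An empty \<open>A\<close> has no enumeration, but then the ratio for \<open>k\<close> would vanish.\<close>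
    have "A \<noteq> {}"
    proof
      assume "A = {}"
      then have "act_set \<phi> (set_power G A k) B = {}"
        using jk by (cases "(G, A, k)" rule: set_power.cases) (auto simp: act_set_def set_mult_def)
      then show False
        using magnification_ratio_le[of B M B \<phi> "set_power G A k"] B ck
        by (simp add: mult_le_0_iff)
    qed
    then have range: "range (from_nat_into A) = A"
      using A assms(2) by (intro range_from_nat_into) (auto intro: countable_subset)
    define T where "T n = \<phi> (from_nat_into A n)" for n
    interpret commuting_transformations M T
      unfolding T_def
      using commuting_transformations_of_action[OF G prob_space.finite_measure[OF assms(3)] act,
          of "from_nat_into A"] from_nat_into[OF \<open>A \<noteq> {}\<close>] A by blast
    have spread_eq: "spread = act_set \<phi> A"
    proof
      fix E
      have "spread E = (\<Union>a\<in>range (from_nat_into A). \<phi> a ` E)" by (simp add: spread_def T_def)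
      also have "\<dots> = act_set \<phi> A E" by (auto simp: range act_set_def)
      finally show "spread E = act_set \<phi> A E" .
    qed
    have "C ^ j \<le> ?c j"
    proof (rule magnification_ratio_ge[OF B])
      fix Z assume Z: "Z \<in> sets M" "Z \<subseteq> B"
      have "C ^ j * measure M Z \<le> measure M ((spread ^^ j) Z)"
      proof (rule iterated_spread_lower_bound[OF B(1) C(1) _ _ _ Z])
        fix Z' assume "Z' \<in> sets M" "Z' \<subseteq> B"
        then show "C ^ k * measure M Z' \<le> measure M ((spread ^^ k) Z')"
          using magnification_ratio_le[of Z' M B \<phi> "set_power G A k"] iterate[of k Z'] jk
          by (simp add: C spread_eq)
      qed (use jk in auto)
      then show "C ^ j * measure M Z \<le> measure M (act_set \<phi> (set_power G A j) Z)"
        using iterate[of j Z] jk Z by (simp add: spread_eq)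
    qed
    then have "(C ^ j) powr (1 / real j) \<le> ?c j powr (1 / real j)"
      using C by (intro powr_mono2) auto
    moreover have "(C ^ j) powr (1 / real j) = C"
      using C jk by (simp add: powr_realpow[symmetric] powr_powr)
    ultimately show ?thesis by (simp add: C_def)
  qed
qed

end
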